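(* Let $\vec m$ be an $n\times n$ difference-bound matrix over $\overline{\mathbb I}$ (with $\mathbb I\in\{\mathbb Z,\mathbb Q,\mathbb R\}$), let $g$ be a guard, i.e. an arithmetic equality or inequality over the variables $\{v_2,\dots,v_n\}$, and let $\vec m_{(g)}$ be the result of the guard transfer function defined in the context. Then $$\mathcal D^0(\vec m_{(g)})\supseteq\{s\in\mathcal D^0(\vec m)\;|\;s\text{ satisfies }g\}.$$
   Context: Let $\mathbb I$ be $\mathbb Z$, $\mathbb Q$ or $\mathbb R$, and $\overline{\mathbb I}=\mathbb I\cup\{+\infty\}$ with the usual extended order, minimum and addition. Variables are $v_1,\dots,v_n$, with $v_1$ standing for the constant $0$ and $v_2,\dots,v_n$ the program variables. A difference-bound matrix (DBM) is an $n\times n$ matrix $\vec m$ with entries in $\overline{\mathbb I}$. Define $\mathcal D(\vec m)=\{(x_1,\dots,x_n)\in\mathbb I^n\;|\;\forall i,j,\ x_j-x_i\leq\vec m_{ij}\}$ and the $\mathcal V^0$-domain $\mathcal D^0(\vec m)=\{(x_2,\dots,x_n)\in\mathbb I^{n-1}\;|\;(0,x_2,\dots,x_n)\in\mathcal D(\vec m)\}$. A point $s=(x_2,\dots,x_n)$ satisfies $g$ if $g$ holds when each $v_i$ takes the value $x_i$. Guard transfer function $\vec m\mapsto\vec m_{(g)}$ (with $c\in\mathbb I$): (1) If $g=(v_{j_0}-v_{i_0}\leq c)$ with $i_0\neq j_0$: $(\vec m_{(g)})_{ij}=\min(\vec m_{ij},c)$ if $i=i_0$ and $j=j_0$, and $\vec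 m_{ij}$ otherwise. The cases $g=(v_{j_0}\leq c)$ and $g=(-v_{i_0}\leq c)$ are treated by taking respectively $i_0=1$ and $j_0=1$. (2) If $g=(v_{j_0}-v_{i_0}=c)$ with $i_0\neq j_0$: $\vec m_{(g)}=(\vec m_{(v_{j_0}-v_{i_0}\leq c)})_{(v_{i_0}-v_{j_0}\leq -c)}$. The case $g=(v_{j_0}=c)$ is the special case $i_0=1$. (3) In all other cases, $\vec m_{(g)}=\vec m$. *)

theory Defs
  imports Complex_Main "HOL-Library.FuncSet" "HOL-Library.Extended_Real"
begin

text \<open>
  The base set \<open>I\<close> is one of the sets of integers, rationals or reals, all regarded as subsets of
  the reals. Indices run over \<open>{1..n}\<close>, and index \<open>1\<close> belongs to the pseudo-variable
  that stands for the constant \<open>0\<close>.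
\<close>

definition ext_set :: "real set \<Rightarrow> ereal set" where
  "ext_set I = ereal ` I \<union> {\<infinity>}"

type_synonym dbm = "nat \<times> nat \<Rightarrow> ereal"

definition DBM :: "real set \<Rightarrow> nat \<Rightarrow> dbm set" where
  "DBM I n = ({1..n} \<times> {1..n} \<rightarrow>\<^sub>E ext_set I)"

definition dbm_dom :: "real set \<Rightarrow> nat \<Rightarrow> dbm \<Rightarrow> (nat \<Rightarrow> real) set" where
  "dbm_dom I n m = {x \<in> {1..n} \<rightarrow>\<^sub>E I.
     \<forall>i\<in>{1..n}. \<forall>j\<in>{1..n}. ereal (x j - x i) \<le> m (i, j)}"

text \<open>Points of the following domain are indexed by \<open>{2..n}\<close>; the update prepends the
  coordinate \<open>0\<close>.\<close>

definition dbm_dom0 :: "real set \<Rightarrow> nat \<Rightarrow> dbm \<Rightarrow> (nat \<Rightarrow> real) set" where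
  "dbm_dom0 I n m = {x \<in> {2..n} \<rightarrow>\<^sub>E I. x(1 := 0) \<in> dbm_dom I n m}"

datatype aexp =
    Const real
  | Var nat
  | Neg aexp
  | Add aexp aexp
  | Sub aexp aexp
  | Mul aexp aexp
  | Div aexp aexp

datatype cmp = Eq | Neq | Le | Lt | Ge | Gt

datatype guard = Guard aexp cmp aexp

fun aexp_vars :: "aexp \<Rightarrow> nat set" where
  "aexp_vars (Const c) = {}"
| "aexp_vars (Var i) = {i}"
| "aexp_vars (Neg a) = aexp_vars a"
| "aexp_vars (Add a b) = aexp_vars a \<union> aexp_vars b"
| "aexp_vars (Sub a b) = aexp_vars a \<union> aexp_vars b"
| "aexp_vars (Mul a b) = aexp_vars a \<union> aexp_vars b"
| "aexp_vars (Div a b) = aexp_vars a \<union> aexp_vars b"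

fun guard_vars :: "guard \<Rightarrow> nat set" where
  "guard_vars (Guard a r b) = aexp_vars a \<union> aexp_vars b"

fun aval :: "(nat \<Rightarrow> real) \<Rightarrow> aexp \<Rightarrow> real" where
  "aval s (Const c) = c"
| "aval s (Var i) = s i"
| "aval s (Neg a) = - aval s a"
| "aval s (Add a b) = aval s a + aval s b"
| "aval s (Sub a b) = aval s a - aval s b"
| "aval s (Mul a b) = aval s a * aval s b"
| "aval s (Div a b) = aval s a / aval s b"

text \<open>Since \<open>x / 0 = 0\<close> in HOL, definedness is tracked separately; a comparison with an
  undefined side does not hold.\<close>

fun defined :: "(nat \<Rightarrow> real) \<Rightarrow> aexp \<Rightarrow> bool" where
  "defined s (Const c) = True"
| "defined s (Var i) = True"
| "defined s (Neg a) = defined s a"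
| "defined s (Add a b) = (defined s a \<and> defined s b)"
| "defined s (Sub a b) = (defined s a \<and> defined s b)"
| "defined s (Mul a b) = (defined s a \<and> defined s b)"
| "defined s (Div a b) = (defined s a \<and> defined s b \<and> aval s b \<noteq> 0)"

fun cmp_holds :: "cmp \<Rightarrow> real \<Rightarrow> real \<Rightarrow> bool" where
  "cmp_holds Eq x y = (x = y)"
| "cmp_holds Neq x y = (x \<noteq> y)"
| "cmp_holds Le x y = (x \<le> y)"
| "cmp_holds Lt x y = (x < y)"
| "cmp_holds Ge x y = (x \<ge> y)"
| "cmp_holds Gt x y = (x > y)"

fun satisfies :: "(nat \<Rightarrow> real) \<Rightarrow> guard \<Rightarrow> bool" where
  "satisfies s (Guard a r b) =
     (defined s a \<and> defined s b \<and> cmp_holds r (aval s a) (aval s b))"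

text \<open>The transfer for \<open>v\<^sub>j - v\<^sub>i \<le> c\<close>, with \<open>i = 1\<close> or
  \<open>j = 1\<close> allowed. The matrix is left unchanged if \<open>i = j\<close> or if \<open>c\<close> does not lie
  in the base set.\<close>

definition add_le :: "real set \<Rightarrow> nat \<Rightarrow> nat \<Rightarrow> real \<Rightarrow> dbm \<Rightarrow> dbm" where
  "add_le I i j c m =
     (if i \<noteq> j \<and> c \<in> I then m((i, j) := min (m (i, j)) (ereal c)) else m)"

definition add_eq :: "real set \<Rightarrow> nat \<Rightarrow> nat \<Rightarrow> real \<Rightarrow> dbm \<Rightarrow> dbm" where
  "add_eq I i j c m = add_le I j i (- c) (add_le I i j c m)"

text \<open>The distinction of cases is on the syntactic shape of the guard.\<close>

definition guard_transfer :: "real set \<Rightarrow> guard \<Rightarrow> dbm \<Rightarrow> dbm" where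
  "guard_transfer I g m = (case g of
       Guard (Sub (Var j) (Var i)) Le (Const c) \<Rightarrow> add_le I i j c m
     | Guard (Var j) Le (Const c) \<Rightarrow> add_le I 1 j c m
     | Guard (Neg (Var i)) Le (Const c) \<Rightarrow> add_le I i 1 c m
     | Guard (Sub (Var j) (Var i)) Eq (Const c) \<Rightarrow> add_eq I i j c m
     | Guard (Var j) Eq (Const c) \<Rightarrow> add_eq I 1 j c m
     | _ \<Rightarrow> m)"

end

theory Submission imports Defs begin

text \<open>Each update replaces an entry by its minimum with a constant. A point satisfying the
  guard obeys both the old bound and the new one, so it is not lost (\<open>dbm_dom_add_le\<close>);
  an equality is two opposite inequalities. This is argued for points with the coordinate 0
  prepended, whose truth value for \<open>g\<close> is unchanged by
  \<open>satisfies_cong\<close>.\<close>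

lemma dbm_dom_add_le:
  assumes "x \<in> dbm_dom I n m" and "x j - x i \<le> c"
  shows "x \<in> dbm_dom I n (add_le I i j c m)"
  using assms by (auto simp: dbm_dom_def add_le_def)

lemma dbm_dom_add_eq:
  assumes "x \<in> dbm_dom I n m" and "x j - x i = c"
  shows "x \<in> dbm_dom I n (add_eq I i j c m)"
  unfolding add_eq_def using assms by (intro dbm_dom_add_le) auto

text \<open>The hypothesis \<open>x 1 = 0\<close> turns a bound on a single variable into a bound on
  a difference with index 1; guards of any other shape leave \<open>m\<close> as it is.\<close>

lemma dbm_dom_guard_transfer:
  assumes "x \<in> dbm_dom I n m" and "x 1 = 0" and "satisfies x g"
  shows "x \<in> dbm_dom I n (guard_transfer I g m)"
  using assms unfolding guard_transfer_def
  by (auto split: guard.split aexp.split cmp.split intro!: dbm_dom_add_le dbm_dom_add_eq)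

lemma aval_cong: "(\<And>i. i \<in> aexp_vars a \<Longrightarrow> s i = t i) \<Longrightarrow> aval s a = aval t a"
  by (induction a) auto

lemma defined_cong:
  "(\<And>i. i \<in> aexp_vars a \<Longrightarrow> s i = t i) \<Longrightarrow> defined s a = defined t a"
proof (induction a)
  case (Div a b)
  \<comment> \<open>Definedness of a quotient also depends on the value of the divisor, which the
    induction hypotheses do not cover.\<close>
  moreover have "aval s b = aval t b"
    using Div.prems by (intro aval_cong) simp
  ultimately show ?case by simp
qed auto

lemma satisfies_cong:
  assumes "\<And>i. i \<in> guard_vars g \<Longrightarrow> s i = t i"
  shows "satisfies s g = satisfies t g"
proof (cases g)
  case (Guard a r b)
  then have "aval s a = aval t a" "aval s b = aval t b"
    "defined s a = defined t a" "defined s b = defined t b"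
    using assms by (auto intro!: aval_cong defined_cong)
  then show ?thesis by (simp add: Guard)
qed

theorem theorem11:
  fixes I :: "real set" and n :: nat and m :: dbm and g :: guard
  assumes "I \<in> {\<int>, \<rat>, \<real>}"
    and "n \<ge> 1"
    and "m \<in> DBM I n"
    and "guard_vars g \<subseteq> {2..n}"
  shows "dbm_dom0 I n (guard_transfer I g m) \<supseteq> {s \<in> dbm_dom0 I n m. satisfies s g}"
proof
  fix s assume "s \<in> {s \<in> dbm_dom0 I n m. satisfies s g}"
  then have s: "s \<in> {2..n} \<rightarrow>\<^sub>E I" "s(1 := 0) \<in> dbm_dom I n m" "satisfies s g"
    by (auto simp: dbm_dom0_def)
  \<comment> \<open>Index 1 lies outside \<open>{2..n}\<close>, so \<open>g\<close> cannot see that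
    the default value of \<open>s\<close> there is overwritten.\<close>
  have "satisfies (s(1 := 0)) g = satisfies s g"
    using assms(4) by (intro satisfies_cong) auto
  with s have "s(1 := 0) \<in> dbm_dom I n (guard_transfer I g m)"
    by (intro dbm_dom_guard_transfer) simp_all
  with s(1) show "s \<in> dbm_dom0 I n (guard_transfer I g m)"
    by (simp add: dbm_dom0_def)
qed

end
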